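(* Let $q=r^{2}$, where $r$ is an odd prime power, and let $m$ be a positive integer with $m\mid q-1$. Let $t$ be an integer with $1\leq t\leq \frac{r+1}{\gcd(r+1,m)}$ and suppose that $tm$ is even. (i) If $\frac{q-1}{m}$ is even and $n=tm$, then there exists a $q$-ary $[n,\frac{n}{2}]$ MDS self-dual code. (ii) If $n=tm+2$, and it is not the case that simultaneously $t$ is even, $m$ is even and $r\equiv 1\pmod 4$, then there exists a $q$-ary $[n,\frac{n}{2}]$ MDS self-dual code.
   Context: $\mathbb{F}_q$ denotes the finite field with $q$ elements. A $q$-ary $[n,k,d]$ code (or $[n,k]$ code, when $d$ is not specified) is an $\mathbb{F}_q$-linear subspace $C\subseteq\mathbb{F}_q^n$ of dimension $k$ with minimum (Hamming) distance $d$. It is called MDS (maximum distance separable) if $k+d=n+1$. The dual $C^{\perp}$ is the orthogonal complement of $C$ in $\mathbb{F}_q^n$ with respect to the standard Euclidean bilinear form $\langle x,y\rangle=\sum_{i=1}^n x_iy_i$, and $C$ is self-dual if $C=C^{\perp}$. An MDS self-dual code of length $n$ thus has parameters $[n,\frac n2,\frac n2+1]$. *)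

theory Defs
  imports "HOL-Analysis.Cartesian_Space" "HOL-Number_Theory.Prime_Powers"
begin

definition is_code :: "nat \<Rightarrow> nat \<Rightarrow> (('a::field)^'n::finite) set \<Rightarrow> bool" where
  "is_code n k C \<longleftrightarrow> CARD('n) = n \<and> vec.subspace C \<and> vec.dim C = k"

definition hamming_dist :: "'a^'n::finite \<Rightarrow> 'a^'n \<Rightarrow> nat" where
  "hamming_dist x y = card {i. x $ i \<noteq> y $ i}"

text \<open>The value is 0 (as the infimum of the empty set of naturals) for a set with at
  most one element; in particular the zero code is not MDS below.\<close>

definition min_dist :: "('a^'n::finite) set \<Rightarrow> nat" where
  "min_dist C = Inf {hamming_dist x y | x y. x \<in> C \<and> y \<in> C \<and> x \<noteq> y}"

definition is_MDS :: "(('a::field)^'n::finite) set \<Rightarrow> bool" where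
  "is_MDS C \<longleftrightarrow> vec.dim C + min_dist C = CARD('n) + 1"

definition bilin :: "('a::field)^'n::finite \<Rightarrow> 'a^'n \<Rightarrow> 'a" where
  "bilin x y = (\<Sum>i\<in>UNIV. x $ i * y $ i)"

definition dual_code :: "(('a::field)^'n::finite) set \<Rightarrow> ('a^'n) set" where
  "dual_code C = {y. \<forall>x\<in>C. bilin x y = 0}"

definition self_dual :: "(('a::field)^'n::finite) set \<Rightarrow> bool" where
  "self_dual C \<longleftrightarrow> C = dual_code C"

end

theory Submission
  imports Defs "HOL-Number_Theory.Residues" "HOL-Computational_Algebra.Polynomial"
begin

text \<open>
  The codes are generalized Reed--Solomon codes on points \<open>A\<close> of the projective line. By Lagrange
  interpolation \<open>\<Sum>a\<in>A. p a / \<delta> a\<close> with \<open>\<delta> a = (\<Prod>b\<in>A - {a}. a - b)\<close> is the coefficient of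
  \<open>p\<close> in degree \<open>card A - 1\<close>, so column multipliers that are square roots of \<open>c / \<delta> a\<close> make
  the code self-dual; what is needed is that all \<open>\<delta> a\<close> have the same quadratic character, and
  that this character is trivial when the point at infinity is used. Take \<open>A\<close> to be
  the set of all \<open>m\<close>-th roots of a set \<open>T\<close> of \<open>t\<close> elements that are \<open>m\<close>-th powers of
  \<open>(r + 1)\<close>-th roots of unity. Then \<open>\<delta> a = m * a ^ (m - 1) * (\<Prod>z\<in>T - {y}. y - z)\<close> with
  \<open>y = a ^ m\<close>, and the Frobenius map shows that the quadratic character of the last product does not
  depend on \<open>y\<close>. In part (ii), with the extra points \<open>0\<close> and infinity, it is trivial after a
  suitable choice of \<open>T\<close>: for \<open>t\<close> even and \<open>m\<close> odd, exchanging one element of \<open>T\<close>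
  flips it, unless \<open>T\<close> is forced, in which case it is already trivial.
\<close>

hide_const (open) UnivPoly.coeff UnivPoly.monom Module.smult

section \<open>Codes with prescribed zero patterns\<close>

text \<open>A Lagrange basis for codes: removing one point \<open>j\<close> from \<open>S\<close>
  leaves a zero set of size \<open>d\<close>, and the word vanishing exactly there is, on
  \<open>S\<close>, a nonzero multiple of the unit vector at \<open>j\<close>. Both the dimension
  count and the self-duality proof rest on it.\<close>

lemma interpolating_family:
  fixes C :: "('a::field^'n::finite) set"
  assumes ex: "\<And>T. card T = d \<Longrightarrow> \<exists>c\<in>C. \<forall>i. c $ i = 0 \<longleftrightarrow> i \<in> T"
    and S: "card S = Suc d"
  obtains c where "\<And>j. j \<in> S \<Longrightarrow> c j \<in> C"
    "\<And>j i. j \<in> S \<Longrightarrow> c j $ i = 0 \<longleftrightarrow> i \<in> S - {j}"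
    "\<And>y i. i \<in> S \<Longrightarrow> (\<Sum>j\<in>S. (y $ j / c j $ j) *s c j) $ i = y $ i"
proof -
  have fS: "finite S" by simp
  have "\<forall>j\<in>S. \<exists>c. c \<in> C \<and> (\<forall>i. c $ i = 0 \<longleftrightarrow> i \<in> S - {j})"
  proof
    fix j assume "j \<in> S"
    then have "card (S - {j}) = d" using S fS by simp
    from ex[OF this] show "\<exists>c. c \<in> C \<and> (\<forall>i. c $ i = 0 \<longleftrightarrow> i \<in> S - {j})" by blast
  qed
  then obtain c where c: "\<And>j. j \<in> S \<Longrightarrow> c j \<in> C"
    "\<And>j i. j \<in> S \<Longrightarrow> c j $ i = 0 \<longleftrightarrow> i \<in> S - {j}" by metis
  have "(\<Sum>j\<in>S. (y $ j / c j $ j) *s c j) $ i = y $ i" if i: "i \<in> S" for y :: "'a^'n" and i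
  proof -
    have "(\<Sum>j\<in>S. (y $ j / c j $ j) *s c j) $ i = (\<Sum>j\<in>S. if j = i then y $ i else 0)"
      unfolding sum_component
    proof (rule sum.cong[OF refl])
      fix j assume j: "j \<in> S"
      show "((y $ j / c j $ j) *s c j) $ i = (if j = i then y $ i else 0)"
        using c(2)[OF j, of i] c(2)[OF j, of j] i by auto
    qed
    also have "\<dots> = y $ i" using i fS by simp
    finally show ?thesis .
  qed
  with c show ?thesis by (rule that)
qed

text \<open>The interpolating words on \<open>Suc d\<close> coordinates form a basis. Reading a
  linear relation at coordinate \<open>j\<close> isolates one scalar; a codeword minus its
  interpolant has more than \<open>d\<close> zeros, so it vanishes.\<close>

lemma dim_if_zero_patterns:
  fixes C :: "('a::field^'n::finite) set"
  assumes sub: "vec.subspace C"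
    and zero: "\<And>c. c \<in> C \<Longrightarrow> d < card {i. c $ i = 0} \<Longrightarrow> c = 0"
    and ex: "\<And>T. card T = d \<Longrightarrow> \<exists>c\<in>C. \<forall>i. c $ i = 0 \<longleftrightarrow> i \<in> T"
    and d: "d < CARD('n)"
  shows "vec.dim C = Suc d"
proof -
  obtain S :: "'n set" where S: "card S = Suc d"
    using obtain_subset_with_card_n[of "Suc d" "UNIV :: 'n set"] d by auto
  then have fS: "finite S" by simp
  obtain c where c: "\<And>j. j \<in> S \<Longrightarrow> c j \<in> C"
    "\<And>j i. j \<in> S \<Longrightarrow> c j $ i = 0 \<longleftrightarrow> i \<in> S - {j}"
    "\<And>y i. i \<in> S \<Longrightarrow> (\<Sum>j\<in>S. (y $ j / c j $ j) *s c j) $ i = y $ i"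
    by (rule interpolating_family[OF ex S]) blast+
  have inj: "inj_on c S"
  proof (rule inj_onI)
    fix i j assume ij: "i \<in> S" "j \<in> S" "c i = c j"
    show "i = j" using c(2)[OF ij(1), of i] c(2)[OF ij(2), of i] ij by auto
  qed
  show ?thesis
  proof (rule vec.dim_unique)
    show "c ` S \<subseteq> C" using c(1) by blast
    show "card (c ` S) = Suc d" using inj S by (simp add: card_image)
    show "vec.independent (c ` S)"
    proof (rule vec.independent_if_scalars_zero)
      show "finite (c ` S)" using fS by simp
      fix f x assume eq: "(\<Sum>x\<in>c ` S. f x *s x) = 0" and "x \<in> c ` S"
      then obtain j where j: "j \<in> S" "x = c j" by blast
      have "0 = (\<Sum>i\<in>S. f (c i) *s c i) $ j"
        using eq by (simp add: sum.reindex[OF inj])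
      also have "\<dots> = (\<Sum>i\<in>S. if i = j then f x * x $ j else 0)"
        unfolding sum_component
      proof (rule sum.cong[OF refl])
        fix i assume i: "i \<in> S"
        show "(f (c i) *s c i) $ j = (if i = j then f x * x $ j else 0)"
          using c(2)[OF i, of j] j by auto
      qed
      also have "\<dots> = f x * x $ j" using j(1) fS by simp
      finally show "f x = 0" using c(2)[OF j(1), of j] j(2) by auto
    qed
    show "C \<subseteq> vec.span (c ` S)"
    proof
      fix y assume y: "y \<in> C"
      let ?z = "\<Sum>j\<in>S. (y $ j / c j $ j) *s c j"
      have z: "?z \<in> C" by (intro vec.subspace_sum vec.subspace_scale sub c(1))
      have "S \<subseteq> {i. (y - ?z) $ i = 0}" using c(3) by auto
      then have "d < card {i. (y - ?z) $ i = 0}"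
        using S card_mono[of "{i. (y - ?z) $ i = 0}" S] by simp
      then have "y - ?z = 0" by (intro zero vec.subspace_diff sub y z)
      moreover have "?z \<in> vec.span (c ` S)"
        by (intro vec.span_sum vec.span_scale vec.span_base) auto
      ultimately show "y \<in> vec.span (c ` S)" by simp
    qed
  qed
qed

text \<open>Distance is length minus the number of zeros of the difference: \<open>zero\<close>
  bounds that number by \<open>d\<close>, and \<open>ex\<close> supplies a word attaining
  it.\<close>

lemma min_dist_if_zero_patterns:
  fixes C :: "('a::field^'n::finite) set"
  assumes sub: "vec.subspace C"
    and zero: "\<And>c. c \<in> C \<Longrightarrow> d < card {i. c $ i = 0} \<Longrightarrow> c = 0"
    and ex: "\<And>T. card T = d \<Longrightarrow> \<exists>c\<in>C. \<forall>i. c $ i = 0 \<longleftrightarrow> i \<in> T"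
    and d: "d < CARD('n)"
  shows "min_dist C = CARD('n) - d"
proof -
  have ham: "hamming_dist x y = CARD('n) - card {i. (x - y) $ i = 0}" for x y :: "'a^'n"
  proof -
    have "{i. x $ i \<noteq> y $ i} = UNIV - {i. (x - y) $ i = 0}" by auto
    then show ?thesis unfolding hamming_dist_def by (simp add: card_Diff_subset)
  qed
  show ?thesis unfolding min_dist_def
  proof (rule cInf_eq_minimum)
    obtain T :: "'n set" where T: "card T = d"
      using obtain_subset_with_card_n[of d "UNIV :: 'n set"] d by auto
    obtain c where c: "c \<in> C" "\<forall>i. c $ i = 0 \<longleftrightarrow> i \<in> T" using ex[OF T] by blast
    have "T \<noteq> UNIV" using T d by auto
    then obtain i where "i \<notin> T" by blast
    then have "c $ i \<noteq> 0" using c(2) by blast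
    then have "c \<noteq> 0" by (metis zero_index)
    moreover have "hamming_dist c 0 = CARD('n) - d" using c(2) T by (simp add: ham)
    ultimately show "CARD('n) - d \<in> {hamming_dist x y |x y. x \<in> C \<and> y \<in> C \<and> x \<noteq> y}"
      using c(1) vec.subspace_0[OF sub] by force
  next
    fix e assume "e \<in> {hamming_dist x y |x y. x \<in> C \<and> y \<in> C \<and> x \<noteq> y}"
    then obtain x y where e: "e = hamming_dist x y" "x \<in> C" "y \<in> C" "x \<noteq> y" by blast
    have "\<not> d < card {i. (x - y) $ i = 0}"
      using zero[OF vec.subspace_diff[OF sub e(2,3)]] e(4) by auto
    then show "CARD('n) - d \<le> e" unfolding e(1) ham by simp
  qed
qed

text \<open>A word \<open>y\<close> orthogonal to \<open>C\<close> agrees with some codeword on half of the coordinates; the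
  difference is supported on the other half, where pairing it with codewords having exactly one
  nonzero entry there shows that it vanishes.\<close>

lemma self_dual_if_zero_patterns:
  fixes C :: "('a::field^'n::finite) set"
  assumes sub: "vec.subspace C"
    and ex: "\<And>T. card T = d \<Longrightarrow> \<exists>c\<in>C. \<forall>i. c $ i = 0 \<longleftrightarrow> i \<in> T"
    and d: "CARD('n) = 2 * Suc d"
    and orth: "\<And>x y. x \<in> C \<Longrightarrow> y \<in> C \<Longrightarrow> bilin x y = 0"
  shows "self_dual C"
proof -
  have "y \<in> C" if y: "\<And>x. x \<in> C \<Longrightarrow> bilin x y = 0" for y
  proof -
    obtain S :: "'n set" where S: "card S = Suc d"
      using obtain_subset_with_card_n[of "Suc d" "UNIV :: 'n set"] d by auto
    have S': "card (- S) = Suc d" using S d by (simp add: Compl_eq_Diff_UNIV card_Diff_subset)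
    obtain c where c: "\<And>j. j \<in> S \<Longrightarrow> c j \<in> C"
      "\<And>i. i \<in> S \<Longrightarrow> (\<Sum>j\<in>S. (y $ j / c j $ j) *s c j) $ i = y $ i"
      by (rule interpolating_family[OF ex S]) blast+
    define z where "z = (\<Sum>j\<in>S. (y $ j / c j $ j) *s c j)"
    have z: "z \<in> C" unfolding z_def by (intro vec.subspace_sum vec.subspace_scale sub c(1))
    have zS: "(y - z) $ i = 0" if "i \<in> S" for i using c(2)[OF that] by (simp add: z_def)
    have "(y - z) $ i = 0" if i: "i \<notin> S" for i
    proof -
      have "card (- S - {i}) = d" using S' i by simp
      then obtain x where x: "x \<in> C" "\<And>j. x $ j = 0 \<longleftrightarrow> j \<in> - S - {i}" using ex by metis
      have "bilin x (y - z) = bilin x y - bilin x z"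
        by (simp add: bilin_def algebra_simps sum_subtractf)
      also have "\<dots> = 0" using y[OF x(1)] orth[OF x(1) z] by simp
      finally have "0 = (\<Sum>j\<in>UNIV. x $ j * (y - z) $ j)" by (simp add: bilin_def)
      also have "\<dots> = (\<Sum>j\<in>UNIV. if j = i then x $ i * (y - z) $ i else 0)"
      proof (rule sum.cong[OF refl])
        fix j
        show "x $ j * (y - z) $ j = (if j = i then x $ i * (y - z) $ i else 0)"
          using x(2)[of j] zS[of j] by (cases "j \<in> S") (use i in auto)
      qed
      also have "\<dots> = x $ i * (y - z) $ i" by simp
      finally show ?thesis using x(2)[of i] by simp
    qed
    then have "y - z = 0" using zS by (metis vec_eq_iff zero_index)
    then show ?thesis using z by simp
  qed
  then show ?thesis unfolding self_dual_def dual_code_def using orth by blast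
qed

section \<open>Evaluation codes on the projective line\<close>

text \<open>The value of a polynomial of degree at most \<open>d\<close> at a point of the projective line, after
  homogenization in degree \<open>d\<close>; \<open>None\<close> is the point at infinity.\<close>

definition proj_eval :: "nat \<Rightarrow> 'a::field poly \<Rightarrow> 'a option \<Rightarrow> 'a" where
  "proj_eval d p s = (case s of None \<Rightarrow> coeff p d | Some x \<Rightarrow> poly p x)"

lemma proj_eval_simps [simp]:
  "proj_eval d p None = coeff p d" "proj_eval d p (Some x) = poly p x"
  by (simp_all add: proj_eval_def)

lemma proj_eval_add: "proj_eval d (p + q) s = proj_eval d p s + proj_eval d q s"
  and proj_eval_smult: "proj_eval d (smult c p) s = c * proj_eval d p s"
  by (cases s; simp)+

lemma proj_eval_0 [simp]: "proj_eval d 0 s = 0"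
  by (cases s) auto

lemma proj_eval_mult:
  assumes "degree p \<le> d" "degree q \<le> e"
  shows "proj_eval (d + e) (p * q) s = proj_eval d p s * proj_eval e q s"
proof (cases s)
  case None
  have "coeff (p * q) (d + e) = coeff p d * coeff q e"
  proof (cases "degree p = d \<and> degree q = e")
    case True
    then show ?thesis using coeff_mult_degree_sum[of p q] by simp
  next
    case False
    then have lt: "degree p < d \<or> degree q < e" using assms by auto
    then have "degree (p * q) < d + e" using degree_mult_le[of p q] assms by linarith
    then show ?thesis using lt by (auto simp: coeff_eq_0)
  qed
  then show ?thesis using None by simp
qed simp

text \<open>Vanishing at infinity kills the coefficient in degree \<open>d\<close>, so infinity
  counts as one root and \<open>d\<close> further roots suffice.\<close>

lemma proj_eval_eq_0_imp_0:
  assumes deg: "degree p \<le> d" and S: "card S > d" and zero: "\<And>s. s \<in> S \<Longrightarrow> proj_eval d p s = 0"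
  shows "p = 0"
proof -
  define A where "A = {x. Some x \<in> S}"
  have fS: "finite S" using S by (rule_tac ccontr) simp
  have rootA: "poly p x = 0" if "x \<in> A" for x using zero[of "Some x"] that by (simp add: A_def)
  show ?thesis
  proof (cases "None \<in> S")
    case False
    have "S = Some ` A" unfolding A_def using False by (auto simp: image_iff) (metis option.exhaust)
    then have "card A > d" using S by (simp add: card_image)
    then show ?thesis using deg rootA by (intro poly_eqI_degree[of A]) auto
  next
    case True
    have "S = insert None (Some ` A)" unfolding A_def using True
      by (auto simp: image_iff) (metis option.exhaust)
    then have "card S = Suc (card A)" using fS by (simp add: card_image finite_image_iff)
    then show ?thesis using deg rootA S zero[OF True]
      by (intro poly_eqI_degree_lead_coeff[of _ d _ A]) auto
  qed
qed

lemma exists_poly_proj_zeros: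
  assumes "finite T"
  shows "\<exists>p::'a::field poly. degree p \<le> card T \<and> (\<forall>s. proj_eval (card T) p s = 0 \<longleftrightarrow> s \<in> T)"
  using assms
proof induction
  case empty
  have "proj_eval 0 (1::'a poly) s \<noteq> 0" for s by (cases s) auto
  then show ?case by (intro exI[of _ 1]) auto
next
  case (insert t T)
  then obtain p :: "'a poly" where p: "degree p \<le> card T"
    "\<And>s. proj_eval (card T) p s = 0 \<longleftrightarrow> s \<in> T" by blast
  \<comment> \<open>As a form of degree 1, the constant 1 vanishes only at infinity, just as
    \<open>[:-x, 1:]\<close> vanishes only at \<open>x\<close>.\<close>
  define l where "l = (case t of None \<Rightarrow> 1 | Some x \<Rightarrow> [:-x, 1:])"
  have l: "degree l \<le> 1" "proj_eval 1 l s = 0 \<longleftrightarrow> s = t" for s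
    by (cases t; simp add: l_def) (cases s; cases t; simp add: l_def)
  have "degree (p * l) \<le> card T + 1" using degree_mult_le[of p l] l(1) p(1) by linarith
  moreover have "proj_eval (card T + 1) (p * l) s = 0 \<longleftrightarrow> s \<in> insert t T" for s
    unfolding proj_eval_mult[OF p(1) l(1)] using p(2) l(2) by auto
  ultimately show ?case using insert.hyps by (intro exI[of _ "p * l"]) simp
qed

text \<open>The code consists of the weighted values on \<open>S\<close> of all polynomials of
  degree at most \<open>d\<close>. The inner product of two codewords is a sum over \<open>S\<close>
  of values of one product polynomial, so \<open>orth\<close> is only required for single
  polynomials of degree at most \<open>2 * d\<close>.\<close>

lemma exists_MDS_self_dual_proj:
  fixes S :: "'a::field option set" and w :: "'a option \<Rightarrow> 'a"
  assumes n: "CARD('n::finite) = 2 * Suc d" and cS: "card S = 2 * Suc d"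
    and w: "\<And>s. s \<in> S \<Longrightarrow> w s \<noteq> 0"
    and orth: "\<And>h. degree h \<le> 2 * d \<Longrightarrow> (\<Sum>s\<in>S. (w s)\<^sup>2 * proj_eval (2 * d) h s) = 0"
  shows "\<exists>C :: ('a^'n) set. is_code (2 * Suc d) (Suc d) C \<and> is_MDS C \<and> self_dual C"
proof -
  have fS: "finite S" using cS card.infinite by fastforce
  obtain a where a: "bij_betw a (UNIV :: 'n set) S"
    using finite_same_card_bij[of "UNIV :: 'n set" S] fS cS n by auto
  have inj: "inj a" and aS: "a i \<in> S" for i
    using a by (auto simp: bij_betw_def)
  define enc :: "'a poly \<Rightarrow> 'a^'n" where "enc p = (\<chi> i. w (a i) * proj_eval d p (a i))" for p
  define C where "C = enc ` {p. degree p \<le> d}"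
  have sub: "vec.subspace C"
  proof (rule vec.subspaceI)
    have "enc 0 = 0" unfolding enc_def vec_eq_iff by simp
    then show "0 \<in> C" unfolding C_def by (intro image_eqI[of _ _ 0]) auto
    fix x y assume "x \<in> C" "y \<in> C"
    then obtain p p' where "x = enc p" "y = enc p'" "degree p \<le> d" "degree p' \<le> d"
      unfolding C_def by blast
    then show "x + y \<in> C" unfolding C_def
      by (intro image_eqI[of _ _ "p + p'"])
        (auto simp: enc_def vec_eq_iff proj_eval_add algebra_simps degree_add_le)
  next
    fix c x assume "x \<in> C"
    then obtain p where "x = enc p" "degree p \<le> d"
      unfolding C_def by blast
    then show "c *s x \<in> C" unfolding C_def
      by (intro image_eqI[of _ _ "Polynomial.smult c p"])
        (auto simp: enc_def vec_eq_iff proj_eval_smult algebra_simps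
           intro: order_trans[OF degree_smult_le])
  qed
  have zero: "c = 0" if c: "c \<in> C" "d < card {i. c $ i = 0}" for c
  proof -
    obtain p where p: "c = enc p" "degree p \<le> d" using c(1) unfolding C_def by blast
    have "p = 0"
    proof (rule proj_eval_eq_0_imp_0[OF p(2)])
      show "d < card (a ` {i. c $ i = 0})" using c(2) inj by (simp add: card_image inj_on_subset)
      show "proj_eval d p s = 0" if "s \<in> a ` {i. c $ i = 0}" for s
        using that w[OF aS] by (auto simp: p(1) enc_def)
    qed
    then show ?thesis unfolding p(1) enc_def vec_eq_iff by simp
  qed
  have ex: "\<exists>c\<in>C. \<forall>i. c $ i = 0 \<longleftrightarrow> i \<in> T" if T: "card T = d" for T
  proof -
    have cT: "card (a ` T) = d" using T inj by (simp add: card_image inj_on_subset)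
    obtain p where p: "degree p \<le> d" "\<And>s. proj_eval d p s = 0 \<longleftrightarrow> s \<in> a ` T"
      using exists_poly_proj_zeros[of "a ` T"] cT by auto
    then have "enc p \<in> C" "\<forall>i. enc p $ i = 0 \<longleftrightarrow> i \<in> T"
      using w[OF aS] inj by (auto simp: C_def enc_def dest: injD)
    then show ?thesis by blast
  qed
  have orthC: "bilin x y = 0" if xy: "x \<in> C" "y \<in> C" for x y
  proof -
    obtain p p' where p: "x = enc p" "y = enc p'" "degree p \<le> d" "degree p' \<le> d"
      using xy unfolding C_def by blast
    have "bilin x y = (\<Sum>i\<in>UNIV. (w (a i))\<^sup>2 * proj_eval (2 * d) (p * p') (a i))"
      unfolding bilin_def p(1,2) enc_def mult_2 proj_eval_mult[OF p(3,4)]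
      by (simp add: power2_eq_square mult_ac)
    also have "\<dots> = (\<Sum>s\<in>S. (w s)\<^sup>2 * proj_eval (2 * d) (p * p') s)"
      by (rule sum.reindex_bij_betw[OF a])
    also have "\<dots> = 0" using degree_mult_le[of p p'] p(3,4) by (intro orth) linarith
    finally show ?thesis .
  qed
  have dn: "d < CARD('n)" using n by simp
  have "is_MDS C" unfolding is_MDS_def
    using dim_if_zero_patterns[OF sub zero ex dn] min_dist_if_zero_patterns[OF sub zero ex dn] n
    by simp
  moreover have "is_code (2 * Suc d) (Suc d) C" unfolding is_code_def
    using sub dim_if_zero_patterns[OF sub zero ex dn] n by simp
  ultimately show ?thesis using self_dual_if_zero_patterns[OF sub ex n orthC] by blast
qed

section \<open>Lagrange interpolation and the resulting self-dual codes\<close>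

lemma monic_prod_linear:
  fixes B :: "'a::field set"
  assumes "finite B"
  shows "degree (\<Prod>b\<in>B. [:-b, 1:]) = card B \<and> coeff (\<Prod>b\<in>B. [:-b, 1:]) (card B) = 1"
  using assms
proof induction
  case (insert b B)
  let ?p = "\<Prod>b\<in>B. [:-b, 1:]"
  have "?p \<noteq> 0" using insert.hyps by (simp add: prod_zero_iff)
  then have "degree ([:-b, 1:] * ?p) = Suc (card B)" using insert.IH by (subst degree_mult_eq) auto
  moreover have "coeff ([:-b, 1:] * ?p) (Suc (card B)) = 1"
    using coeff_mult_degree_sum[of "[:-b, 1:]" ?p] insert.IH by simp
  ultimately show ?case using insert.hyps by simp
qed simp

text \<open>Each Lagrange basis polynomial is a monic polynomial of degree \<open>card A - 1\<close>
  divided by its value at \<open>a\<close>; comparing coefficients in that degree in the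
  interpolation formula gives the sum.\<close>

lemma sum_lagrange_leading_coeff:
  fixes A :: "'a::field set"
  assumes A: "finite A" and deg: "degree h < card A"
  shows "(\<Sum>a\<in>A. poly h a / (\<Prod>b\<in>A - {a}. a - b)) = coeff h (card A - 1)"
proof -
  define \<delta> where "\<delta> a = (\<Prod>b\<in>A - {a}. a - b)" for a
  define l where "l a = (\<Prod>b\<in>A - {a}. [:-b, 1:])" for a
  define L where "L = (\<Sum>a\<in>A. Polynomial.smult (poly h a / \<delta> a) (l a))"
  have l: "degree (l a) = card A - 1" "coeff (l a) (card A - 1) = 1" if "a \<in> A" for a
    using monic_prod_linear[of "A - {a}"] A that by (auto simp: l_def)
  have "h = L"
  proof (rule poly_eqI_degree[of A])
    fix x assume x: "x \<in> A"
    have "poly L x = (\<Sum>a\<in>A. if a = x then poly h x else 0)"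
      unfolding L_def poly_sum
    proof (rule sum.cong[OF refl])
      fix a assume a: "a \<in> A"
      show "poly (Polynomial.smult (poly h a / \<delta> a) (l a)) x = (if a = x then poly h x else 0)"
        using A x a by (auto simp: l_def \<delta>_def poly_prod prod_zero_iff)
    qed
    then show "poly h x = poly L x" using A x by simp
  next
    have "degree L \<le> card A - 1" unfolding L_def
      by (rule degree_sum_le[OF A]) (metis degree_smult_le l(1))
    then show "card A > degree L" using deg by linarith
  qed (rule deg)
  then have "coeff h (card A - 1) = coeff L (card A - 1)" by simp
  also have "\<dots> = (\<Sum>a\<in>A. poly h a / \<delta> a)" unfolding L_def coeff_sum
    by (rule sum.cong[OF refl]) (simp add: l del: One_nat_def)
  finally show ?thesis by (simp add: \<delta>_def)
qed

text \<open>The weights have squares \<open>c / \<delta> a\<close>, so the orthogonality sum is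
  \<open>c\<close> times the coefficient of \<open>h\<close> in degree \<open>2 * d + 1\<close>,
  which exceeds the degree of \<open>h\<close>.\<close>

lemma exists_MDS_self_dual_affine:
  fixes A :: "'a::field set"
  assumes n: "CARD('n::finite) = 2 * Suc d" and cA: "card A = 2 * Suc d" and "c \<noteq> 0"
    and sq: "\<And>a. a \<in> A \<Longrightarrow> \<exists>v. v\<^sup>2 = c * (\<Prod>b\<in>A - {a}. a - b)"
  shows "\<exists>C :: ('a^'n) set. is_code (2 * Suc d) (Suc d) C \<and> is_MDS C \<and> self_dual C"
proof -
  have fA: "finite A" using cA card.infinite by fastforce
  define \<delta> where "\<delta> a = (\<Prod>b\<in>A - {a}. a - b)" for a
  have \<delta>0: "\<delta> a \<noteq> 0" for a using fA by (auto simp: \<delta>_def prod_zero_iff)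
  obtain v where v: "\<And>a. a \<in> A \<Longrightarrow> (v a)\<^sup>2 = c * \<delta> a" using sq unfolding \<delta>_def by metis
  define w where "w s = v (the s) / \<delta> (the s)" for s
  show ?thesis
  proof (rule exists_MDS_self_dual_proj[OF n, of "Some ` A" w])
    show "card (Some ` A) = 2 * Suc d" using cA by (simp add: card_image)
    show "w s \<noteq> 0" if "s \<in> Some ` A" for s
      using that v \<delta>0 \<open>c \<noteq> 0\<close> unfolding w_def by force
    fix h :: "'a poly" assume h: "degree h \<le> 2 * d"
    have "(\<Sum>s\<in>Some ` A. (w s)\<^sup>2 * proj_eval (2 * d) h s) = (\<Sum>a\<in>A. c * (poly h a / \<delta> a))"
      by (simp add: sum.reindex w_def power_divide v power2_eq_square[of "\<delta> _"] \<delta>0 field_simps)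
    also have "\<dots> = c * (\<Sum>a\<in>A. poly h a / \<delta> a)" by (simp only: sum_distrib_left)
    also have "\<dots> = c * coeff h (card A - 1)"
      using sum_lagrange_leading_coeff[OF fA, of h] h cA by (simp add: \<delta>_def)
    also have "\<dots> = 0" using h cA by (simp add: coeff_eq_0)
    finally show "(\<Sum>s\<in>Some ` A. (w s)\<^sup>2 * proj_eval (2 * d) h s) = 0" .
  qed
qed

text \<open>With one finite point fewer, the sum over \<open>A\<close> is the coefficient of
  \<open>h\<close> in degree \<open>2 * d\<close>. This is the value of \<open>h\<close> at
  infinity, and the squared weight -1 there cancels it.\<close>

lemma exists_MDS_self_dual_infinity:
  fixes A :: "'a::field set"
  assumes n: "CARD('n::finite) = 2 * Suc d" and cA: "card A = Suc (2 * d)"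
    and neg: "\<exists>u. u\<^sup>2 = (-1 :: 'a)"
    and sq: "\<And>a. a \<in> A \<Longrightarrow> \<exists>v. v\<^sup>2 = (\<Prod>b\<in>A - {a}. a - b)"
  shows "\<exists>C :: ('a^'n) set. is_code (2 * Suc d) (Suc d) C \<and> is_MDS C \<and> self_dual C"
proof -
  have fA: "finite A" using cA card.infinite by fastforce
  define \<delta> where "\<delta> a = (\<Prod>b\<in>A - {a}. a - b)" for a
  have \<delta>0: "\<delta> a \<noteq> 0" for a using fA by (auto simp: \<delta>_def prod_zero_iff)
  obtain v where v: "\<And>a. a \<in> A \<Longrightarrow> (v a)\<^sup>2 = \<delta> a" using sq unfolding \<delta>_def by metis
  obtain u where u: "u\<^sup>2 = (-1::'a)" using neg by blast
  define w where "w s = (case s of None \<Rightarrow> u | Some a \<Rightarrow> inverse (v a))" for s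
  show ?thesis
  proof (rule exists_MDS_self_dual_proj[OF n, of "insert None (Some ` A)" w])
    show "card (insert None (Some ` A)) = 2 * Suc d" using cA fA by (simp add: card_image)
    show "w s \<noteq> 0" if "s \<in> insert None (Some ` A)" for s
      using that v \<delta>0 u unfolding w_def by (force split: option.splits)
    fix h :: "'a poly" assume h: "degree h \<le> 2 * d"
    have "(\<Sum>s\<in>insert None (Some ` A). (w s)\<^sup>2 * proj_eval (2 * d) h s)
        = (\<Sum>a\<in>A. poly h a / \<delta> a) - coeff h (2 * d)"
      using fA by (simp add: sum.reindex w_def u power_inverse v field_simps)
    also have "\<dots> = 0"
      using sum_lagrange_leading_coeff[OF fA, of h] h cA by (simp add: \<delta>_def)
    finally show "(\<Sum>s\<in>insert None (Some ` A). (w s)\<^sup>2 * proj_eval (2 * d) h s) = 0" .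
  qed
qed

section \<open>Finite fields and fibres of power maps\<close>

lemma power_card_minus_1_finite_field:
  fixes x :: "'a::{field,finite}"
  assumes "x \<noteq> 0"
  shows "x ^ (CARD('a) - 1) = 1"
proof -
  have "bij_betw ((*) x) (UNIV - {0}) (UNIV - {0})"
    by (rule bij_betw_byWitness[of _ "\<lambda>y. y / x"]) (use assms in auto)
  then have "(\<Prod>y\<in>UNIV - {0}. x * y) = (\<Prod>y\<in>UNIV - {0}. y)"
    by (rule prod.reindex_bij_betw)
  moreover have "(\<Prod>y\<in>UNIV - {0}. x * y) = x ^ (CARD('a) - 1) * (\<Prod>y\<in>UNIV - {0}. y)"
    by (simp add: prod.distrib card_Diff_subset)
  moreover have "(\<Prod>y\<in>UNIV - {0::'a}. y) \<noteq> 0" by (simp add: prod_zero_iff)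
  ultimately show ?thesis by simp
qed

text \<open>The field type is repackaged as a ring record \<open>R\<close> so that the cyclicity of
  the multiplicative group, stated for records, can be transferred back.\<close>

lemma finite_field_generator:
  obtains g :: "'a::{field,finite}" where "g \<noteq> 0" "\<And>x. x \<noteq> 0 \<Longrightarrow> \<exists>i::nat. x = g ^ i"
proof -
  define R :: "'a ring" where "R = \<lparr>carrier = (UNIV :: 'a set), mult = (*), one = 1, zero = 0, add = (+)\<rparr>"
  have "cring R"
    by (rule cringI; unfold_locales?)
      (auto simp: R_def algebra_simps Units_def intro!: exI[of _ "- _"] intro: add.right_inverse)
  then interpret R: cring R .
  have "Units R = carrier R - {\<zero>\<^bsub>R\<^esub>}"
    unfolding R_def Units_def by auto (metis field_class.field_inverse mult.commute)
  then interpret R: field R by unfold_locales (auto simp: R_def)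
  have pow: "x [^]\<^bsub>R\<^esub> (i::nat) = x ^ i" for x i
    by (induction i) (auto simp: R_def R.nat_pow_Suc nat_pow_def mult.commute)
  have "finite (carrier R)" by (simp add: R_def)
  from R.finite_field_mult_group_has_gen[OF this] obtain a
    where "a \<in> carrier (mult_of R)" "carrier (mult_of R) = {a [^]\<^bsub>R\<^esub> i |i::nat. i \<in> UNIV}" by blast
  then have "a \<noteq> 0" "\<And>x. x \<noteq> 0 \<Longrightarrow> \<exists>i::nat. x = a ^ i"
    unfolding pow by (auto simp: carrier_mult_of R_def set_eq_iff)
  then show ?thesis by (rule that)
qed

lemma finite_field_generator_power_eq_1_iff:
  obtains g :: "'a::{field,finite}" where "g \<noteq> 0" "\<And>x. x \<noteq> 0 \<Longrightarrow> \<exists>i::nat. x = g ^ i"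
    "\<And>i. g ^ i = 1 \<longleftrightarrow> CARD('a) - 1 dvd i"
proof -
  obtain g :: 'a where g: "g \<noteq> 0" "\<And>x. x \<noteq> 0 \<Longrightarrow> \<exists>i::nat. x = g ^ i"
    by (rule finite_field_generator) blast
  define N where "N = CARD('a) - 1"
  have N: "g ^ N = 1" unfolding N_def using g(1) by (rule power_card_minus_1_finite_field)
  have mod: "g ^ (i mod k) = g ^ i" if "g ^ k = 1" for i k
    by (metis mod_mult_div_eq mult.right_neutral mult.commute power_add power_mult power_one that)
  have ge: "N \<le> i" if i: "g ^ i = 1" "0 < i" for i
  proof -
    \<comment> \<open>If \<open>g ^ i = 1\<close>, the first \<open>i\<close> powers already exhaust
      the nonzero elements, so \<open>i\<close> cannot be below their number.\<close>
    have "UNIV - {0} \<subseteq> (\<lambda>j. g ^ j) ` {..<i}"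
    proof
      fix x :: 'a assume "x \<in> UNIV - {0}"
      then obtain j where "x = g ^ j" using g(2) by blast
      then have "x = g ^ (j mod i)" using mod[OF i(1)] by simp
      then show "x \<in> (\<lambda>j. g ^ j) ` {..<i}" using i(2) by auto
    qed
    then have "card (UNIV - {0::'a}) \<le> i"
      by (metis card_image_le card_lessThan card_mono finite_imageI finite_lessThan le_trans)
    then show ?thesis by (simp add: N_def card_Diff_subset)
  qed
  have "CARD('a) > 1"
    using card_mono[of "UNIV :: 'a set" "{0, 1}"] by simp
  then have N0: "N > 0" by (simp add: N_def)
  have "g ^ i = 1 \<longleftrightarrow> N dvd i" for i
  proof
    assume "g ^ i = 1"
    then have "g ^ (i mod N) = 1" using mod[OF N] by simp
    then have "i mod N = 0" using ge[of "i mod N"] N0 by (meson mod_less_divisor not_gr0 not_le)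
    then show "N dvd i" by auto
  next
    assume "N dvd i"
    then show "g ^ i = 1" using N by (auto simp: power_mult)
  qed
  then show ?thesis using g that unfolding N_def by blast
qed

lemma finite_field_element_of_order:
  assumes "d dvd CARD('a::{field,finite}) - 1"
  obtains w :: "'a::{field,finite}" where "\<And>i. w ^ i = 1 \<longleftrightarrow> d dvd i"
proof -
  obtain g :: 'a where g: "\<And>i. g ^ i = 1 \<longleftrightarrow> CARD('a) - 1 dvd i"
    by (rule finite_field_generator_power_eq_1_iff) blast
  obtain k where k: "CARD('a) - 1 = d * k" using assms by blast
  have "CARD('a) > 1" using card_mono[of "UNIV :: 'a set" "{0, 1}"] by simp
  then have "k > 0" using k by (intro Nat.gr0I) auto
  then have "(g ^ k) ^ i = 1 \<longleftrightarrow> d dvd i" for i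
    using g[of "k * i"] k by (simp add: power_mult[symmetric] mult.commute[of d k])
  then show ?thesis by (rule that)
qed

text \<open>For \<open>x = g ^ i\<close> the hypothesis makes \<open>2 * H\<close> divide
  \<open>i * H\<close>, so \<open>i\<close> is even and half of it is the exponent of a square
  root.\<close>

lemma finite_field_euler_criterion:
  fixes x :: "'a::{field,finite}"
  assumes odd: "odd CARD('a)" and x: "x ^ ((CARD('a) - 1) div 2) = 1"
  shows "\<exists>v. v\<^sup>2 = x"
proof (cases "x = 0")
  case False
  obtain g :: 'a where g: "\<And>x. x \<noteq> 0 \<Longrightarrow> \<exists>i::nat. x = g ^ i"
    "\<And>i. g ^ i = 1 \<longleftrightarrow> CARD('a) - 1 dvd i"
    by (rule finite_field_generator_power_eq_1_iff) blast
  define H where "H = (CARD('a) - 1) div 2"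
  have H: "CARD('a) - 1 = 2 * H" using odd by (simp add: H_def)
  have "CARD('a) > 1" using card_mono[of "UNIV :: 'a set" "{0, 1}"] by simp
  then have "H > 0" using H by simp
  obtain i where i: "x = g ^ i" using g(1) False by blast
  have "g ^ (i * H) = 1" using x by (simp add: i power_mult H_def)
  then have "2 * H dvd i * H" using g(2) H by simp
  then obtain j where "i = 2 * j" using \<open>H > 0\<close> by auto
  then have "(g ^ j)\<^sup>2 = x" by (simp add: i power_mult mult.commute flip: power_mult)
  then show ?thesis by blast
qed (auto intro: exI[of _ 0])

text \<open>This makes \<open>x ^ r\<close> a power of the Frobenius map, hence additive.\<close>

lemma CHAR_finite_field_primepow:
  fixes r :: nat
  assumes "primepow r" and card: "CARD('a::{field,finite}) = r\<^sup>2"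
  shows "prime CHAR('a)" "\<exists>k. r = CHAR('a) ^ k"
proof -
  show p: "prime CHAR('a)"
    by (rule prime_CHAR_semidom) (simp add: finite_imp_CHAR_pos)
  obtain p k where pk: "prime p" "r = p ^ k" using assms(1) by (auto simp: primepow_def)
  have "CHAR('a) dvd r\<^sup>2" using CHAR_dvd_CARD[where ?'a = 'a] card by simp
  then have "CHAR('a) dvd p" using p unfolding pk(2) by (meson prime_dvd_power)
  then have "CHAR('a) = p" using p pk(1) by (simp add: primes_dvd_imp_eq)
  then show "\<exists>k. r = CHAR('a) ^ k" using pk(2) by blast
qed

section \<open>Fibres of the m-th power map and products of differences over them\<close>

lemma card_power_fiber:
  fixes c :: "'a::{field,finite}"
  assumes m: "m > 0" "m dvd CARD('a) - 1" and c: "c \<noteq> 0"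
  shows "card {b. b ^ m = c ^ m} = m"
proof (rule antisym)
  \<comment> \<open>The fibre is the coset through \<open>c\<close> of the m-th roots of unity: the
    powers of an element of order \<open>m\<close> give at least \<open>m\<close> members, and the
    root bound for X^m - c^m gives at most \<open>m\<close>.\<close>
  obtain w :: 'a where w: "\<And>i. w ^ i = 1 \<longleftrightarrow> m dvd i"
    by (rule finite_field_element_of_order[OF m(2)]) blast
  have w0: "w \<noteq> 0" using w[of m] m(1) by (auto simp: power_0_left)
  have inj: "inj_on (\<lambda>j. c * w ^ j) {..<m}"
  proof (rule linorder_inj_onI)
    fix i j assume ij: "i < j" "i \<in> {..<m}" "j \<in> {..<m}"
    have "w ^ (j - i) \<noteq> 1" using ij w[of "j - i"] by (auto dest: dvd_imp_le)
    moreover have "w ^ j = w ^ i * w ^ (j - i)" using ij by (simp flip: power_add)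
    ultimately show "c * w ^ i \<noteq> c * w ^ j" using c w0 by simp
  qed auto
  have "(\<lambda>j. c * w ^ j) ` {..<m} \<subseteq> {b. b ^ m = c ^ m}"
    using w by (auto simp: power_mult_distrib simp flip: power_mult)
  then show "m \<le> card {b. b ^ m = c ^ m}"
    using card_mono[of "{b. b ^ m = c ^ m}" "(\<lambda>j. c * w ^ j) ` {..<m}"] inj by (simp add: card_image)
  let ?p = "monom 1 m - [:c ^ m:]"
  have deg: "degree ?p \<le> m"
    by (rule degree_diff_le) (auto simp: degree_monom_le)
  have "coeff ?p m = 1" using m(1) by (simp add: coeff_pCons split: nat.splits)
  then have "?p \<noteq> 0" by (metis coeff_0 zero_neq_one)
  then have "card {b. poly ?p b = 0} \<le> m" using card_poly_roots_bound[of ?p] deg by linarith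
  then show "card {b. b ^ m = c ^ m} \<le> m" by (simp add: poly_monom)
qed

text \<open>Both sides are monic of degree \<open>m\<close> and vanish on the same \<open>m\<close>
  points.\<close>

lemma prod_linear_power_fiber:
  fixes y :: "'a::{field,finite}"
  assumes m: "m > 0" and card: "card {b. b ^ m = y} = m"
  shows "(\<Prod>b | b ^ m = y. [:-b, 1:]) = monom 1 m - [:y:]"
proof (rule poly_eqI_degree_lead_coeff[where n = m and A = "{b. b ^ m = y}"])
  show "coeff (\<Prod>b | b ^ m = y. [:-b, 1:]) m = coeff (monom 1 m - [:y:]) m"
    using monic_prod_linear[of "{b. b ^ m = y}"] card m
    by (simp add: coeff_pCons split: nat.splits)
  show "degree (\<Prod>b | b ^ m = y. [:-b, 1:]) \<le> m"
    using monic_prod_linear[of "{b. b ^ m = y}"] card by simp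
  show "degree (monom 1 m - [:y:]) \<le> m"
    by (rule degree_diff_le) (auto simp: degree_monom_le)
qed (use card in \<open>auto simp: poly_prod poly_monom prod_zero_iff\<close>)

lemma prod_diff_power_fiber:
  fixes y :: "'a::{field,finite}"
  assumes "m > 0" "card {b. b ^ m = y} = m"
  shows "(\<Prod>b | b ^ m = y. x - b) = x ^ m - y"
  using arg_cong[OF prod_linear_power_fiber[OF assms], of "\<lambda>p. poly p x"]
  by (simp add: poly_prod poly_monom)

text \<open>Differentiating a product of distinct linear factors and evaluating at the root
  \<open>a\<close> leaves the product of the other factors; the derivative of X^m - a^m gives its
  value.\<close>

lemma prod_diff_own_power_fiber:
  fixes a :: "'a::{field,finite}"
  assumes "m > 0" "card {b. b ^ m = a ^ m} = m"
  shows "(\<Prod>b\<in>{b. b ^ m = a ^ m} - {a}. a - b) = of_nat m * a ^ (m - 1)"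
proof -
  let ?R = "{b. b ^ m = a ^ m}"
  have "(\<Prod>b\<in>?R. [:-b, 1:]) = [:-a, 1:] * (\<Prod>b\<in>?R - {a}. [:-b, 1:])"
    by (subst prod.remove[of _ a]) auto
  then have "poly (pderiv (\<Prod>b\<in>?R. [:-b, 1:])) a = (\<Prod>b\<in>?R - {a}. a - b)"
    by (simp only: pderiv_mult poly_add poly_mult poly_prod) (simp add: pderiv_pCons)
  moreover have "poly (pderiv (monom 1 m - [:a ^ m:])) a = of_nat m * a ^ (m - 1)"
    by (simp add: pderiv_diff pderiv_monom poly_monom pderiv_pCons)
  ultimately show ?thesis using prod_linear_power_fiber[OF assms] by simp
qed

lemma power_preimage:
  fixes T :: "'a::{field,finite} set"
  assumes m: "m > 0" and fib: "\<And>y. y \<in> T \<Longrightarrow> card {b. b ^ m = y} = m"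
  shows card_power_preimage: "card {x. x ^ m \<in> T} = card T * m"
    and prod_diff_power_preimage: "(\<Prod>b | b ^ m \<in> T. x - b) = (\<Prod>y\<in>T. x ^ m - y)"
proof -
  have eq: "{x. x ^ m \<in> T} = (\<Union>y\<in>T. {b. b ^ m = y})" by auto
  show "card {x. x ^ m \<in> T} = card T * m"
    unfolding eq by (subst card_UN_disjoint) (auto simp: fib)
  have "(\<Prod>b | b ^ m \<in> T. x - b) = (\<Prod>y\<in>T. \<Prod>b | b ^ m = y. x - b)"
    unfolding eq by (rule prod.UNION_disjoint) auto
  also have "\<dots> = (\<Prod>y\<in>T. x ^ m - y)"
    using prod_diff_power_fiber[OF m fib] by simp
  finally show "(\<Prod>b | b ^ m \<in> T. x - b) = (\<Prod>y\<in>T. x ^ m - y)" .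
qed

text \<open>The fibre through \<open>a\<close> contributes the derivative of X^m, and every other
  fibre, over \<open>y\<close>, contributes \<open>a ^ m - y\<close>.\<close>

lemma prod_diff_own_power_preimage:
  fixes T :: "'a::{field,finite} set"
  assumes m: "m > 0" and fib: "\<And>y. y \<in> T \<Longrightarrow> card {b. b ^ m = y} = m" and a: "a ^ m \<in> T"
  shows "(\<Prod>b\<in>{x. x ^ m \<in> T} - {a}. a - b)
    = of_nat m * a ^ (m - 1) * (\<Prod>y\<in>T - {a ^ m}. a ^ m - y)"
proof -
  have "{x. x ^ m \<in> T} - {a} = ({b. b ^ m = a ^ m} - {a}) \<union> {x. x ^ m \<in> T - {a ^ m}}"
    using a by auto
  then have "(\<Prod>b\<in>{x. x ^ m \<in> T} - {a}. a - b)
      = (\<Prod>b\<in>{b. b ^ m = a ^ m} - {a}. a - b) * (\<Prod>b | b ^ m \<in> T - {a ^ m}. a - b)"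
    by (simp only:) (rule prod.union_disjoint, auto)
  also have "\<dots> = of_nat m * a ^ (m - 1) * (\<Prod>y\<in>T - {a ^ m}. a ^ m - y)"
    using prod_diff_own_power_fiber[OF m fib[OF a]]
      prod_diff_power_preimage[OF m, of "T - {a ^ m}"] fib by simp
  finally show ?thesis .
qed

section \<open>Differences of roots of unity\<close>

text \<open>Since \<open>z ^ r = 1 / z\<close> for \<open>(r + 1)\<close>-th roots of unity, the Frobenius \<open>x \<mapsto> x ^ r\<close> maps
  \<open>y - z\<close> to \<open>- (y - z) / (y * z)\<close>; this determines the quadratic character of \<open>y - z\<close>.\<close>

lemma power_diff_roots_of_unity:
  fixes y z :: "'a::{field,finite}"
  assumes r: "odd r" "primepow r" "CARD('a) = r\<^sup>2"
    and y: "y ^ (r + 1) = 1" and z: "z ^ (r + 1) = 1" and "y \<noteq> z"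
  shows "(y - z) ^ ((r\<^sup>2 - 1) div 2) = (-1) ^ ((r + 1) div 2) * y ^ ((r + 1) div 2) * z ^ ((r + 1) div 2)"
proof -
  define h where "h = (r + 1) div 2"
  have h: "r + 1 = 2 * h" using r(1) by (simp add: h_def)
  have r0: "r > 0" using r(1) by (rule odd_pos)
  \<comment> \<open>The quadratic character is thus the \<open>h\<close>-th power of
    \<open>(y - z) ^ (r - 1)\<close>, a quantity known from Frobenius.\<close>
  have half: "(r\<^sup>2 - 1) div 2 = (r - 1) * h"
  proof -
    have "r\<^sup>2 - 1 = (r - 1) * (r + 1)" by (simp add: power2_eq_square algebra_simps)
    then show ?thesis unfolding h by simp
  qed
  obtain k where k: "r = CHAR('a) ^ k" using CHAR_finite_field_primepow(2)[OF r(2,3)] by blast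
  have "((y - z) + z) ^ r = (y - z) ^ r + z ^ r"
    by (rule freshmans_dream'[OF CHAR_finite_field_primepow(1)[OF r(2,3)] k])
  then have frob: "(y - z) ^ r = y ^ r - z ^ r" by (simp add: algebra_simps)
  have "(y - z) ^ r * (y * z) = y ^ (r + 1) * z - z ^ (r + 1) * y"
    unfolding frob by (simp add: algebra_simps)
  also have "\<dots> = - (y - z)" unfolding y z by simp
  finally have "(y - z) * ((y - z) ^ (r - 1) * (y * z)) = (y - z) * (-1)"
    using r0 by (simp add: power_eq_if mult_ac)
  then have "(y - z) ^ (r - 1) * (y * z) = -1" using \<open>y \<noteq> z\<close> by (metis eq_iff_diff_eq_0 mult_left_cancel)
  then have "((y - z) ^ (r - 1) * (y * z)) ^ h = (-1) ^ h" by (rule arg_cong)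
  then have "(y - z) ^ ((r - 1) * h) * (y ^ h * z ^ h) = (-1) ^ h"
    by (simp add: power_mult_distrib power_mult)
  then have "(y - z) ^ ((r - 1) * h) * ((y ^ h * y ^ h) * (z ^ h * z ^ h)) = (-1) ^ h * y ^ h * z ^ h"
    by (metis (no_types, opaque_lifting) mult.assoc mult.commute)
  \<comment> \<open>Both \<open>y ^ h\<close> and \<open>z ^ h\<close> are their own inverses, so
    they may stand on either side.\<close>
  moreover have "y ^ h * y ^ h = 1" "z ^ h * z ^ h = 1"
    using y z unfolding h mult_2 power_add by simp_all
  ultimately show ?thesis unfolding half h_def[symmetric] by simp
qed

text \<open>Multiplying the characters of the single differences leaves a dependence on
  \<open>y\<close> only through \<open>(y ^ h) ^ card T\<close>: one factor \<open>y ^ h\<close> is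
  spent on completing the product over \<open>T - {y}\<close> to a product over
  \<open>T\<close>.\<close>

lemma power_prod_diff_roots_of_unity:
  fixes T :: "'a::{field,finite} set"
  assumes r: "odd r" "primepow r" "CARD('a) = r\<^sup>2"
    and T: "\<And>z. z \<in> T \<Longrightarrow> z ^ (r + 1) = 1" and y: "y \<in> T"
  shows "(\<Prod>z\<in>T - {y}. y - z) ^ ((r\<^sup>2 - 1) div 2)
    = (-1) ^ ((r + 1) div 2 * (card T - 1)) * (y ^ ((r + 1) div 2)) ^ card T
      * (\<Prod>z\<in>T. z ^ ((r + 1) div 2))"
proof -
  define h where "h = (r + 1) div 2"
  define t where "t = card T - 1"
  have h: "r + 1 = 2 * h" using r(1) by (simp add: h_def)
  have ct: "card T = Suc t" using y card_gt_0_iff[of T] by (auto simp: t_def)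
  have yy: "y ^ h * y ^ h = 1" using T[OF y] unfolding h mult_2 power_add by simp
  have "(\<Prod>z\<in>T - {y}. y - z) ^ ((r\<^sup>2 - 1) div 2) = (\<Prod>z\<in>T - {y}. (-1) ^ h * y ^ h * z ^ h)"
    unfolding prod_power_distrib h_def
    by (rule prod.cong[OF refl], rule power_diff_roots_of_unity[OF r]) (use T y in auto)
  also have "\<dots> = (-1) ^ (h * t) * (y ^ h) ^ t * (\<Prod>z\<in>T - {y}. z ^ h)"
    using ct y by (simp add: prod.distrib t_def power_mult power_mult_distrib)
  also have "(y ^ h) ^ t = (y ^ h) ^ card T * y ^ h" using yy ct by (simp add: mult_ac)
  also have "(-1) ^ (h * t) * ((y ^ h) ^ card T * y ^ h) * (\<Prod>z\<in>T - {y}. z ^ h)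
    = (-1) ^ (h * t) * (y ^ h) ^ card T * (y ^ h * (\<Prod>z\<in>T - {y}. z ^ h))"
    by (simp only: mult_ac)
  also have "y ^ h * (\<Prod>z\<in>T - {y}. z ^ h) = (\<Prod>z\<in>T. z ^ h)"
    using y by (simp add: prod.remove)
  finally show ?thesis by (simp add: h_def t_def)
qed

text \<open>Take the \<open>m\<close>-th powers of \<open>\<beta> ^ s\<close> for \<open>s\<close>
  in \<open>I\<close>, where \<open>\<beta>\<close> has order \<open>r + 1\<close>. As
  \<open>\<beta> ^ h = -1\<close>, their \<open>h\<close>-th powers are the signs
  \<open>(-1) ^ (m * s)\<close>. Evenness of \<open>card I * m\<close> removes the dependence on
  \<open>y\<close>, and the product of the signs puts \<open>m * \<Sum>I\<close> into the
  exponent.\<close>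

lemma exists_evaluation_classes:
  fixes I :: "nat set"
  assumes r: "odd r" "primepow r" "CARD('a::{field,finite}) = r\<^sup>2"
    and m: "m > 0" and I: "I \<subseteq> {..<(r + 1) div gcd (r + 1) m}" and even: "even (card I * m)"
  shows "\<exists>T :: 'a set. card T = card I \<and>
    (\<forall>y\<in>T. (\<exists>c. c ^ (r + 1) = 1 \<and> y = c ^ m) \<and>
      (\<Prod>z\<in>T - {y}. y - z) ^ ((r\<^sup>2 - 1) div 2)
        = (-1) ^ ((r + 1) div 2 * (card I - 1) + m * \<Sum>I))"
proof -
  define h where "h = (r + 1) div 2"
  have h: "r + 1 = 2 * h" using r(1) by (simp add: h_def)
  have h0: "h > 0" using h by (intro Nat.gr0I) auto
  have "r\<^sup>2 - 1 = (r + 1) * (r - 1)" by (simp add: power2_eq_square algebra_simps)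
  then have "(r + 1) dvd CARD('a) - 1" unfolding r(3) by (simp only: dvd_triv_left)
  then obtain \<beta> :: 'a where \<beta>: "\<And>i. \<beta> ^ i = 1 \<longleftrightarrow> (r + 1) dvd i"
    by (rule finite_field_element_of_order) blast
  have \<beta>0: "\<beta> \<noteq> 0" using \<beta>[of "r + 1"] by (auto simp: power_0_left)
  have "(\<beta> ^ h)\<^sup>2 = 1" using \<beta>[of "2 * h"] h by (simp add: power_mult[symmetric] mult.commute)
  moreover have "\<beta> ^ h \<noteq> 1" using \<beta>[of h] h h0 by (auto dest!: dvd_imp_le)
  ultimately have \<beta>h: "\<beta> ^ h = -1" by (simp add: power2_eq_1_iff)
  define \<zeta> where "\<zeta> s = (\<beta> ^ s) ^ m" for s
  have \<zeta>h: "\<zeta> s ^ h = (-1) ^ (m * s)" for s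
  proof -
    have "\<zeta> s ^ h = (\<beta> ^ h) ^ (m * s)" unfolding \<zeta>_def by (simp add: mult_ac flip: power_mult)
    then show ?thesis by (simp add: \<beta>h)
  qed
  have inj: "inj_on \<zeta> I"
  proof (rule linorder_inj_onI)
    fix i j assume ij: "i < j" "i \<in> I" "j \<in> I"
    \<comment> \<open>The \<open>m\<close>-th power of \<open>\<beta>\<close> has order
      \<open>(r + 1) div gcd (r + 1) m\<close>, which is larger than any difference of indices in
      \<open>I\<close>.\<close>
    have "\<not> (r + 1) dvd (j - i) * m"
    proof
      assume "(r + 1) dvd (j - i) * m"
      then have "(r + 1) dvd gcd ((j - i) * (r + 1)) ((j - i) * m)"
        by (rule gcd_greatest[OF dvd_triv_right])
      then have "(r + 1) dvd (j - i) * gcd (r + 1) m" by (simp add: gcd_mult_distrib_nat)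
      then have "(r + 1) div gcd (r + 1) m dvd j - i" by (simp add: dvd_div_iff_mult div_dvd_iff_mult)
      then have "(r + 1) div gcd (r + 1) m \<le> j - i" using ij(1) by (intro dvd_imp_le) auto
      moreover have "j < (r + 1) div gcd (r + 1) m" using ij(3) I by auto
      ultimately show False by linarith
    qed
    then have "\<beta> ^ ((j - i) * m) \<noteq> 1" using \<beta> by blast
    moreover have "\<zeta> j = \<zeta> i * \<beta> ^ ((j - i) * m)"
      using ij(1) by (simp add: \<zeta>_def flip: power_mult power_add add_mult_distrib)
    ultimately show "\<zeta> i \<noteq> \<zeta> j" using \<beta>0 by (simp add: \<zeta>_def)
  qed auto
  define T where "T = \<zeta> ` I"
  have cT: "card T = card I" using inj by (simp add: T_def card_image)
  have cls: "\<exists>c. c ^ (r + 1) = 1 \<and> y = c ^ m" if y: "y \<in> T" for y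
  proof -
    obtain s where "y = (\<beta> ^ s) ^ m" using y unfolding T_def \<zeta>_def by blast
    moreover have "(\<beta> ^ s) ^ (r + 1) = 1" unfolding power_mult[symmetric] \<beta> by (rule dvd_triv_right)
    ultimately show ?thesis by blast
  qed
  have unity: "y ^ (r + 1) = 1" if "y \<in> T" for y
    using cls[OF that] by (metis power_mult mult.commute power_one)
  have "(\<Prod>z\<in>T - {y}. y - z) ^ ((r\<^sup>2 - 1) div 2) = (-1) ^ (h * (card I - 1) + m * \<Sum>I)"
    if y: "y \<in> T" for y
  proof -
    obtain s where s: "y = \<zeta> s" using y by (auto simp: T_def)
    have "(y ^ h) ^ card I = ((-1) ^ (card I * m)) ^ s"
      unfolding s \<zeta>h by (simp add: mult_ac flip: power_mult)
    also have "\<dots> = 1" using even by simp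
    finally have 1: "(y ^ h) ^ card I = 1" .
    have "(\<Prod>z\<in>T. z ^ h) = (\<Prod>s\<in>I. (-1) ^ (m * s))"
      unfolding T_def by (simp add: prod.reindex[OF inj] \<zeta>h)
    also have "\<dots> = (-1) ^ (m * \<Sum>I)" by (simp add: power_sum sum_distrib_left)
    finally show ?thesis
      using power_prod_diff_roots_of_unity[OF r unity y, folded h_def] 1
      by (simp add: cT power_add)
  qed
  then show ?thesis using cT cls unfolding h_def by blast
qed

text \<open>For \<open>t\<close> even and \<open>m\<close> odd, the sign exponent of the evaluation
  classes has the parity of \<open>(r + 1) div 2 + \<Sum>I\<close>. If the initial segment has the
  wrong parity, raising its largest index by one corrects it.\<close>

lemma exists_index_set_parity:
  fixes r m t :: nat
  assumes r: "odd r" and t0: "t \<ge> 1" and t: "t \<le> (r + 1) div gcd (r + 1) m"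
  shows "\<exists>I. I \<subseteq> {..<(r + 1) div gcd (r + 1) m} \<and> card I = t \<and>
    (even t \<and> odd m \<longrightarrow> even ((r + 1) div 2 + \<Sum>I))"
proof (cases "even t \<and> odd m \<and> odd ((r + 1) div 2 + \<Sum>{..<t})")
  case False
  then show ?thesis using t by (intro exI[of _ "{..<t}"]) auto
next
  case True
  define M where "M = (r + 1) div gcd (r + 1) m"
  obtain u where u: "t = 2 * u" using True by blast
  define h where "h = (r + 1) div 2"
  have h: "r + 1 = 2 * h" using r by (simp add: h_def)
  have sum: "\<Sum>{..<2 * u} = u * (2 * u - 1)" for u :: nat
  proof (induction u)
    case (Suc u)
    have "\<Sum>{..<2 * Suc u} = \<Sum>{..<2 * u} + 2 * u + (2 * u + 1)" by simp
    also have "\<dots> = Suc u * (2 * Suc u - 1)" unfolding Suc.IH by (cases u) (auto simp: algebra_simps)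
    finally show ?case .
  qed simp
  have u0: "u > 0" using t0 u by simp
  then have "odd (2 * u - 1)" by simp
  then have "even (\<Sum>{..<t}) = even u" unfolding u sum by simp
  then have uh: "odd (h + u)" using True by (simp add: h_def)
  \<comment> \<open>With all indices in use there would be no room for an exchange. But then
    \<open>h\<close> is \<open>u\<close> times an odd gcd, so \<open>h + u\<close> is even and the
    initial segment would already have the right parity.\<close>
  have "t \<noteq> M"
  proof
    assume "t = M"
    then have "2 * u * gcd (r + 1) m = 2 * h" using u h unfolding M_def by simp
    then have "h = u * gcd (r + 1) m" by simp
    moreover have "odd (gcd (r + 1) m)" using True by (meson dvd_trans gcd_dvd2)
    ultimately show False using uh by (metis even_add even_mult_iff)
  qed
  then have tM: "t < M" using t by (simp add: M_def)
  let ?I = "insert t {..<t - 1}"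
  have "{..<t} = insert (t - 1) {..<t - 1}" using u u0 by auto
  then have "\<Sum>{..<t} = t - 1 + \<Sum>{..<t - 1}" by simp
  moreover have "\<Sum>?I = t + \<Sum>{..<t - 1}" by simp
  ultimately have "\<Sum>?I = Suc (\<Sum>{..<t})" using u u0 by simp
  then have "even (h + \<Sum>?I)" using True by (simp add: h_def)
  moreover have "card ?I = t" using u u0 by simp
  ultimately show ?thesis using tM unfolding M_def h_def by (intro exI[of _ ?I]) auto
qed

section \<open>The codes\<close>

theorem theorem1:
  fixes q r m t n :: nat
  assumes "odd r" and "primepow r" and "q = r\<^sup>2"
    and "m > 0" and "m dvd q - 1"
    and "1 \<le> t" and "t \<le> (r + 1) div gcd (r + 1) m"
    and "even (t * m)"
    and "CARD('a::{field,finite}) = q"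
    and "CARD('n::finite) = n"
  shows "(even ((q - 1) div m) \<and> n = t * m \<longrightarrow>
            (\<exists>C :: ('a^'n) set. is_code n (n div 2) C \<and> is_MDS C \<and> self_dual C))
       \<and> (n = t * m + 2 \<and> \<not> (even t \<and> even m \<and> r mod 4 = 1) \<longrightarrow>
            (\<exists>C :: ('a^'n) set. is_code n (n div 2) C \<and> is_MDS C \<and> self_dual C))"
proof -
  define h where "h = (r + 1) div 2"
  define H where "H = (r\<^sup>2 - 1) div 2"
  have r: "odd r" "primepow r" "CARD('a) = r\<^sup>2" using assms by simp_all
  have oddq: "odd CARD('a)" using r by simp
  have r1: "r - 1 + 1 = r" using r(1) by (cases r) auto
  obtain u where u: "r - 1 = 2 * u" using r(1) by (auto elim!: oddE)
  \<comment> \<open>Two factorizations of the Euler exponent \<open>H\<close> follow: as a multiple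
    of \<open>r + 1\<close> it makes \<open>(r + 1)\<close>-th roots of unity squares; as a multiple
    of \<open>r - 1\<close> it does the same for nonzero elements fixed by \<open>x ^ r\<close>, and
    shows that -1 is a square.\<close>
  have "r\<^sup>2 - 1 = (r - 1) * (r + 1)" by (simp add: power2_eq_square algebra_simps)
  then have H1: "H = (r + 1) * u" and "r\<^sup>2 - 1 = 2 * H" unfolding H_def u by simp_all
  then have H2: "q - 1 = 2 * H" using assms(3) by simp
  have H3: "H = (r - 1) * h" unfolding H1 u using r(1) by (auto simp: h_def elim!: oddE)
  have evenH: "even H" using H3 u by simp
  have neg: "(-1 :: 'a) ^ H = 1" using evenH by simp
  have unity: "c ^ H = 1" if "c ^ (r + 1) = 1" for c :: 'a
    unfolding H1 power_mult that by simp
  have full: "x ^ (2 * H) = 1" if "x \<noteq> 0" for x :: 'a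
    using power_card_minus_1_finite_field[OF that] H2 assms(3) r(3) by simp
  have square: "\<exists>v. v\<^sup>2 = x" if "x ^ H = 1" for x :: 'a
    using finite_field_euler_criterion[OF oddq, of x] that by (simp add: r(3) H_def)

  obtain I where I: "I \<subseteq> {..<(r + 1) div gcd (r + 1) m}" "card I = t"
      "even t \<and> odd m \<longrightarrow> even ((r + 1) div 2 + \<Sum>I)"
    using exists_index_set_parity[OF assms(1,6,7)] by blast
  \<comment> \<open>The quadratic character shared by the products of differences at all
    \<open>y\<close> in \<open>T\<close>.\<close>
  define \<kappa> :: 'a where "\<kappa> = (-1) ^ (h * (t - 1) + m * \<Sum>I)"
  obtain T :: "'a set" where cT: "card T = t"
    and T: "\<And>y. y \<in> T \<Longrightarrow> \<exists>c. c ^ (r + 1) = 1 \<and> y = c ^ m"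
    and prodT: "\<And>y. y \<in> T \<Longrightarrow> (\<Prod>z\<in>T - {y}. y - z) ^ H = \<kappa>"
    using exists_evaluation_classes[OF r assms(4) I(1)] assms(8) unfolding I(2) H_def \<kappa>_def h_def
    by blast
  have unityT: "y ^ H = 1" if "y \<in> T" for y
    using T[OF that] unity by (metis power_mult mult.commute power_one)
  have "m dvd CARD('a) - 1" using assms(3,5) r(3) by simp
  have fib: "card {b. b ^ m = y} = m" if y: "y \<in> T" for y
  proof -
    obtain c where c: "c ^ (r + 1) = 1" "y = c ^ m" using T[OF y] by blast
    then have "c \<noteq> 0" by (auto simp: power_0_left)
    then show ?thesis unfolding c(2)
      by (rule card_power_fiber[OF assms(4) \<open>m dvd CARD('a) - 1\<close>])
  qed
  define A where "A = {x. x ^ m \<in> T}"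
  have cA: "card A = t * m"
    using card_power_preimage[OF assms(4), of T] fib cT by (simp add: A_def)
  define \<delta> where "\<delta> a = (\<Prod>b\<in>A - {a}. a - b)" for a
  have \<delta>: "\<delta> a = of_nat m * a ^ (m - 1) * (\<Prod>y\<in>T - {a ^ m}. a ^ m - y)" if "a \<in> A" for a
    using prod_diff_own_power_preimage[OF assms(4), of T a] fib that by (simp add: \<delta>_def A_def)
  have \<delta>0: "\<delta> a \<noteq> 0" for a by (auto simp: \<delta>_def prod_zero_iff)
  have zero: "0 \<notin> A"
  proof
    assume "0 \<in> A"
    then obtain c :: 'a where "c ^ (r + 1) = 1" "0 = c ^ m"
      using T[of 0] assms(4) by (auto simp: A_def power_0_left)
    then show False by simp
  qed

  show ?thesis
  proof (intro conjI impI; elim conjE)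
    assume ev: "even ((q - 1) div m)" and n: "n = t * m"
    \<comment> \<open>Since \<open>m\<close> divides \<open>H\<close>, \<open>a ^ H\<close> depends
      only on \<open>a ^ m = c ^ m\<close>; so it equals \<open>c ^ H\<close>, which is 1.\<close>
    obtain l where l: "H = m * l"
    proof -
      obtain k where "q - 1 = m * k" using assms(5) by blast
      moreover obtain l where "(q - 1) div m = 2 * l" using ev by blast
      ultimately have "2 * H = m * (2 * l)" using H2 assms(4) by simp
      then show ?thesis by (intro that[of l]) simp
    qed
    have AH: "a ^ H = 1" if a: "a \<in> A" for a
    proof -
      obtain c where c: "c ^ (r + 1) = 1" "a ^ m = c ^ m" using T a by (auto simp: A_def)
      then have "a ^ H = c ^ H" unfolding l power_mult by simp
      then show ?thesis using unity[OF c(1)] by simp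
    qed
    have \<delta>H: "\<delta> a ^ H = of_nat m ^ H * \<kappa>" if a: "a \<in> A" for a
    proof -
      have "(a ^ (m - 1)) ^ H = 1" using AH[OF a] by (metis power_mult mult.commute power_one)
      moreover have "a ^ m \<in> T" using a by (simp add: A_def)
      ultimately show ?thesis unfolding \<delta>[OF a] by (simp add: power_mult_distrib prodT)
    qed
    have "t * m > 0" using assms(4,6) by simp
    then obtain d where d: "t * m = 2 * Suc d" using assms(8)
      by (metis evenE gr0_implies_Suc nat_0_less_mult_iff)
    have "A \<noteq> {}" using cA d by auto
    then obtain a where a: "a \<in> A" by blast
    have "\<exists>C :: ('a^'n) set. is_code (2 * Suc d) (Suc d) C \<and> is_MDS C \<and> self_dual C"
    \<comment> \<open>The scaling constant is \<open>\<delta> a\<close> for one fixed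
      \<open>a\<close>: all \<open>\<delta> b\<close> have the same quadratic character, so every
      product \<open>\<delta> a * \<delta> b\<close> is a square.\<close>
    proof (rule exists_MDS_self_dual_affine)
      show "CARD('n) = 2 * Suc d" "card A = 2 * Suc d" using d n assms(10) cA by simp_all
      show "\<delta> a \<noteq> 0" by (rule \<delta>0)
      fix b assume b: "b \<in> A"
      have "(\<delta> a * \<delta> b) ^ H = \<delta> a ^ (2 * H)"
        using \<delta>H[OF a] \<delta>H[OF b] by (simp add: power_mult_distrib mult_2 power_add)
      then show "\<exists>v. v\<^sup>2 = \<delta> a * (\<Prod>c\<in>A - {b}. b - c)"
        using square full[OF \<delta>0] unfolding \<delta>_def by simp
    qed
    then show "\<exists>C :: ('a^'n) set. is_code n (n div 2) C \<and> is_MDS C \<and> self_dual C"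
      unfolding n d by simp
  next
    assume n: "n = t * m + 2" and notall: "\<not> (even t \<and> even m \<and> r mod 4 = 1)"
    \<comment> \<open>For \<open>t\<close> odd, both \<open>t - 1\<close> and \<open>m\<close> are
      even. For \<open>t\<close> even and \<open>m\<close> odd, this is the choice of
      \<open>I\<close>. For both even, \<open>r\<close> is 3 modulo 4, so \<open>h\<close> is
      even.\<close>
    have "even (h * (t - 1) + m * \<Sum>I)"
    proof (cases "even t")
      case False
      then show ?thesis using assms(8) by simp
    next
      case True
      then have t1: "odd (t - 1)" using assms(6) by simp
      show ?thesis
      proof (cases "even m")
        case False
        then show ?thesis using I(3) True t1 by (simp add: h_def)
      next
        case even_m: True
        then have "r mod 4 \<noteq> 1" using notall True by blast
        then have "even h" using r(1) unfolding h_def by presburger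
        then show ?thesis using even_m by simp
      qed
    qed
    then have \<kappa>: "\<kappa> = 1" by (simp add: \<kappa>_def)
    \<comment> \<open>The element \<open>of_nat m\<close> is a sum of ones, so Frobenius fixes it;
      being nonzero, it is therefore a square.\<close>
    have "(of_nat m :: 'a) ^ r = of_nat m"
    proof -
      obtain k where "r = CHAR('a) ^ k" using CHAR_finite_field_primepow(2)[OF r(2,3)] by blast
      from freshmans_dream_sum'[OF CHAR_finite_field_primepow(1)[OF r(2,3)] this,
          of "\<lambda>_. 1" "{..<m}"]
      show ?thesis by simp
    qed
    moreover have m0: "(of_nat m :: 'a) \<noteq> 0"
    proof -
      have "A \<noteq> {}" using cA assms(4,6) by auto
      then obtain a where "a \<in> A" by blast
      then show ?thesis using \<delta>[of a] \<delta>0[of a] by auto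
    qed
    ultimately have "(of_nat m :: 'a) ^ (r - 1) = 1"
      by (metis r1 power_add power_one_right mult_cancel_right1)
    then have mH: "(of_nat m :: 'a) ^ H = 1" unfolding H3 power_mult by simp
    obtain d where d: "t * m = 2 * d" using assms(8) by blast
    \<comment> \<open>The extra point 0 contributes a factor \<open>a\<close> to the product at
      \<open>a\<close>, turning \<open>a ^ (m - 1)\<close> into \<open>a ^ m\<close>, which lies in
      \<open>T\<close> and is thus a square.\<close>
    define B where "B = insert 0 A"
    have prodB: "(\<Prod>b\<in>B - {a}. a - b) ^ H = 1" if a: "a \<in> B" for a
    proof (cases "a = 0")
      case True
      \<comment> \<open>At 0 the product is that of all \<open>- y\<close> with \<open>y\<close> in
        \<open>T\<close>, and both -1 and \<open>y\<close> are squares.\<close>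
      have "(\<Prod>b\<in>B - {a}. a - b) = (\<Prod>y\<in>T. 0 ^ m - y)"
        using prod_diff_power_preimage[OF assms(4), of T 0] fib zero True by (simp add: B_def A_def)
      also have "\<dots> ^ H = (\<Prod>y\<in>T. (- 1) ^ H * y ^ H)"
        unfolding prod_power_distrib using assms(4)
        by (intro prod.cong refl) (simp add: power_0_left flip: power_mult_distrib)
      also have "\<dots> = 1" using neg unityT by simp
      finally show ?thesis .
    next
      case False
      then have aA: "a \<in> A" using a by (simp add: B_def)
      then have amT: "a ^ m \<in> T" by (simp add: A_def)
      have "B - {a} = insert 0 (A - {a})" using False by (auto simp: B_def)
      then have "(\<Prod>b\<in>B - {a}. a - b) = a * \<delta> a" using zero by (simp add: \<delta>_def)
      also have "\<dots> = of_nat m * a ^ m * (\<Prod>y\<in>T - {a ^ m}. a ^ m - y)"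
        unfolding \<delta>[OF aA] using assms(4) by (cases m) (simp_all add: mult_ac)
      also have "\<dots> ^ H = 1"
        using mH unityT[OF amT] prodT[OF amT] \<kappa> by (simp add: power_mult_distrib)
      finally show ?thesis .
    qed
    have "\<exists>C :: ('a^'n) set. is_code (2 * Suc d) (Suc d) C \<and> is_MDS C \<and> self_dual C"
    proof (rule exists_MDS_self_dual_infinity)
      show "CARD('n) = 2 * Suc d" using d n assms(10) by simp
      show "card B = Suc (2 * d)" using zero cA d by (simp add: B_def)
      show "\<exists>u. u\<^sup>2 = (-1 :: 'a)" using square neg by blast
      show "\<exists>v. v\<^sup>2 = (\<Prod>b\<in>B - {a}. a - b)" if "a \<in> B" for a using square prodB[OF that] by blast
    qed
    then show "\<exists>C :: ('a^'n) set. is_code n (n div 2) C \<and> is_MDS C \<and> self_dual C"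
      unfolding n d by simp
  qed
qed

end
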